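(* There is a constant $C$ such that for every set $S \subset \mathbb{N}$ (finite or infinite) with $H(S)<\infty$, $$I(S) \leq 2\cdot H(S) + C\log_2(H(S)+2) + C.$$
   Context: A deterministic enumerating machine $D$ is an algorithm that takes a finite binary string $x$ as input and, possibly running forever, outputs (enumerates) natural numbers; the set it enumerates on $x$ is the set of all numbers it ever outputs (possibly infinite). For a set $S\subset\mathbb{N}$, $I_D(S)$ is the minimum length of a binary string $x$ such that $D$ on input $x$ enumerates exactly $S$ ($I_D(S)=\infty$ if none exists). There is a universal machine $D_0$: for every $D$ there is a constant $c$ with $I_{D_0}(S) \le I_D(S)+c$ for all $S$ (note the direction: $D_0$ is at most a constant worse than any $D$). Define $I(S) = I_{D_0}(S)$ for a fixed such universal $D_0$ (well defined up to an additive constant). A probabilistic enumerating machine $M$ is an algorithm that may request arbitrarily many independent uniformly random bits and, possibly running forever, enumerates natural numbers; thus it induces a map from the Cantor space $\{0,1\}^{\mathbb{N}}$ (with the uniform measure) to subsets of $\mathbb{N}$, sending a bit sequence $w$ to the set enumerated when $w$ supplies the random bits. Define $H_M(S) = -\log_2 \Pr[M \text{ enumerates exactly } S]$ (infinite if the probability is $0$). There is an optimal machine $M_0$: for every $M$ there is a constant $c$ with $H_{M_0}(S) \le H_M(S) + c$ for all $S$. Define $H(S) = H_{M_0}(S)$ for a fixed such optimal $M_0$ (well defined up to an additive constant). *)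

theory Defs
  imports "HOL-Probability.Probability" "HOL-Library.Nat_Bijection" "HOL-Library.Extended_Nat"
begin

inductive total_rec :: "(nat \<Rightarrow> nat) \<Rightarrow> bool" where
  tr_const: "total_rec (\<lambda>_. k)"
| tr_suc: "total_rec Suc"
| tr_id: "total_rec (\<lambda>n. n)"
| tr_fst: "total_rec (\<lambda>n. fst (prod_decode n))"
| tr_snd: "total_rec (\<lambda>n. snd (prod_decode n))"
| tr_pair: "total_rec f \<Longrightarrow> total_rec g \<Longrightarrow> total_rec (\<lambda>n. prod_encode (f n, g n))"
| tr_comp: "total_rec f \<Longrightarrow> total_rec g \<Longrightarrow> total_rec (\<lambda>n. f (g n))"
| tr_primrec: "total_rec f \<Longrightarrow> total_rec g \<Longrightarrow>
    total_rec (\<lambda>n. rec_nat (f (fst (prod_decode n)))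
                  (\<lambda>i r. g (prod_encode (fst (prod_decode n), prod_encode (i, r))))
                  (snd (prod_decode n)))"
| tr_mu: "total_rec f \<Longrightarrow> (\<forall>x. \<exists>y. f (prod_encode (x, y)) = 0) \<Longrightarrow>
    total_rec (\<lambda>x. LEAST y. f (prod_encode (x, y)) = 0)"

definition enc_str :: "bool list \<Rightarrow> nat" where
  "enc_str x = list_encode (map of_bool x)"

definition dec_opt :: "nat \<Rightarrow> nat option" where
  "dec_opt n = (if n = 0 then None else Some (n - 1))"

text \<open>A deterministic enumerating machine is described by its step behaviour:
  D x t = Some y means that at step t, on input x, the machine outputs y;
  None means no output at that step. It must be computable.\<close>

definition det_machine :: "(bool list \<Rightarrow> nat \<Rightarrow> nat option) \<Rightarrow> bool" where
  "det_machine D \<longleftrightarrow> (\<exists>f. total_rec f \<and>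
      (\<forall>x t. D x t = dec_opt (f (prod_encode (enc_str x, t)))))"

definition det_enum :: "(bool list \<Rightarrow> nat \<Rightarrow> nat option) \<Rightarrow> bool list \<Rightarrow> nat set" where
  "det_enum D x = {y. \<exists>t. D x t = Some y}"

definition I_det :: "(bool list \<Rightarrow> nat \<Rightarrow> nat option) \<Rightarrow> nat set \<Rightarrow> enat" where
  "I_det D S = (INF x\<in>{x. det_enum D x = S}. enat (length x))"

definition universal_det :: "(bool list \<Rightarrow> nat \<Rightarrow> nat option) \<Rightarrow> bool" where
  "universal_det D0 \<longleftrightarrow> det_machine D0 \<and>
     (\<forall>D. det_machine D \<longrightarrow> (\<exists>c::nat. \<forall>S. I_det D0 S \<le> I_det D S + enat c))"

text \<open>A probabilistic enumerating machine is described by M \<sigma> = Some y meaning that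
  after having read exactly the random bits \<sigma> (one step per bit), the machine outputs y.\<close>

definition prob_machine :: "(bool list \<Rightarrow> nat option) \<Rightarrow> bool" where
  "prob_machine M \<longleftrightarrow> (\<exists>f. total_rec f \<and> (\<forall>\<sigma>. M \<sigma> = dec_opt (f (enc_str \<sigma>))))"

definition prefix :: "nat \<Rightarrow> (nat \<Rightarrow> bool) \<Rightarrow> bool list" where
  "prefix n w = map w [0..<n]"

definition prob_enum :: "(bool list \<Rightarrow> nat option) \<Rightarrow> (nat \<Rightarrow> bool) \<Rightarrow> nat set" where
  "prob_enum M w = {y. \<exists>n. M (prefix n w) = Some y}"

definition cantor :: "(nat \<Rightarrow> bool) measure" where
  "cantor = (\<Pi>\<^sub>M i\<in>(UNIV::nat set). measure_pmf (bernoulli_pmf (1/2)))"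

definition H_prob :: "(bool list \<Rightarrow> nat option) \<Rightarrow> nat set \<Rightarrow> ereal" where
  "H_prob M S = (let p = measure cantor {w \<in> space cantor. prob_enum M w = S}
                 in if p = 0 then \<infinity> else ereal (- log 2 p))"

definition optimal_prob :: "(bool list \<Rightarrow> nat option) \<Rightarrow> bool" where
  "optimal_prob M0 \<longleftrightarrow> prob_machine M0 \<and>
     (\<forall>M. prob_machine M \<longrightarrow> (\<exists>c::real. \<forall>S. H_prob M0 S \<le> H_prob M S + ereal c))"

end

theory Submission
  imports Defs
begin

text \<open>Fix \<open>k > H(S)\<close>, so that \<open>S\<close> has probability more than \<open>2 ^ -k\<close>. We run about \<open>4 ^ k / 2\<close> programs
  (tokens) that play a game going back to D. A. Martin. A request is a finite set \<open>T\<close> that, up to a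
  bound \<open>m\<close>, is the current output for a set \<open>E\<close> of random sequences; it has to be served by a token
  whose output so far is contained in \<open>T\<close>, and this token then outputs \<open>T\<close> and remembers \<open>E\<close>. All
  sequences remembered by tokens whose output is not contained in \<open>T\<close> are removed from \<open>E\<close>, and the
  request counts only if the rest has measure at least \<open>2 ^ -k\<close>. Hence the sets remembered by unusable
  tokens are disjoint from \<open>E\<close>. Arrange the tokens in levels \<open>0, 1, ...\<close> with \<open>2 ^ k - j\<close> tokens
  at level \<open>j\<close>, such that the remembered sets of each level are disjoint. A request is served by a
  usable token of the highest possible level \<open>j\<close>. As level \<open>j + 1\<close> contains no usable
  token, the invariant survives if the other tokens of levels \<open>j\<close> and \<open>j + 1\<close> are swapped. Level \<open>0\<close>
  has \<open>2 ^ k\<close> disjoint sets, so by measure some token is always usable.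

  Suppose no token enumerates \<open>S\<close>. Then from some time on every token whose output is
  contained in \<open>S\<close> omits some element of \<open>S\<close> below a fixed bound \<open>b\<close>. When most sequences producing
  \<open>S\<close> have output all of \<open>S \<inter> {..<b}\<close>, they can no longer be remembered by such a token, except
  by those that have not moved since. For \<open>m\<close> beyond the outputs of the latter, the request
  \<open>S \<inter> {..<m}\<close> therefore counts eventually, and it is served, a contradiction.\<close>

section \<open>Closure properties of total recursive functions\<close>

lemma rec_pair:
  assumes "total_rec f" "total_rec g"
  shows "total_rec (\<lambda>e. prod_encode (f e, g e))"
  using assms by (rule tr_pair)

lemma rec_fst: "total_rec f \<Longrightarrow> total_rec (\<lambda>e. fst (prod_decode (f e)))"
  by (rule tr_comp[OF tr_fst])

lemma rec_snd: "total_rec f \<Longrightarrow> total_rec (\<lambda>e. snd (prod_decode (f e)))"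
  by (rule tr_comp[OF tr_snd])

lemma rec_Suc: "total_rec f \<Longrightarrow> total_rec (\<lambda>e. Suc (f e))"
  by (rule tr_comp[OF tr_suc])

lemma rec_comp2:
  assumes "total_rec (\<lambda>z. h (fst (prod_decode z)) (snd (prod_decode z)))" "total_rec f" "total_rec g"
  shows "total_rec (\<lambda>e. h (f e) (g e))"
  using tr_comp[OF assms(1) tr_pair[OF assms(2,3)]] by simp

lemma rec_primrec:
  assumes "total_rec n" "total_rec f"
    and "total_rec (\<lambda>z. g (fst (prod_decode z)) (fst (prod_decode (snd (prod_decode z))))
                          (snd (prod_decode (snd (prod_decode z)))))"
  shows "total_rec (\<lambda>e. rec_nat (f e) (g e) (n e))"
  using tr_comp[OF tr_primrec[OF assms(2,3)] tr_pair[OF tr_id assms(1)]] by simp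

lemma rec_add:
  assumes "total_rec f" "total_rec g"
  shows "total_rec (\<lambda>e. f e + g e)"
proof -
  have "total_rec (\<lambda>e. rec_nat (f e) (\<lambda>_ r. Suc r) (g e))"
    by (intro rec_primrec assms rec_Suc rec_fst rec_snd tr_id)
  moreover have "rec_nat a (\<lambda>_ r. Suc r) b = a + b" for a b :: nat
    by (induction b) auto
  ultimately show ?thesis by simp
qed

lemma rec_mult:
  assumes "total_rec f" "total_rec g"
  shows "total_rec (\<lambda>e. f e * g e)"
proof -
  have "total_rec (\<lambda>e. rec_nat 0 (\<lambda>_ r. r + f e) (g e))"
    by (intro rec_primrec assms tr_const rec_add rec_fst rec_snd tr_id tr_comp[OF assms(1)])
  moreover have "rec_nat 0 (\<lambda>_ r. r + a) b = a * b" for a b :: nat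
    by (induction b) auto
  ultimately show ?thesis by simp
qed

lemma rec_power:
  assumes "total_rec f" "total_rec g"
  shows "total_rec (\<lambda>e. f e ^ g e)"
proof -
  have "total_rec (\<lambda>e. rec_nat 1 (\<lambda>_ r. r * f e) (g e))"
    by (intro rec_primrec assms tr_const rec_mult rec_fst rec_snd tr_id tr_comp[OF assms(1)])
  moreover have "rec_nat 1 (\<lambda>_ r. r * a) b = a ^ b" for a b :: nat
    by (induction b) auto
  ultimately show ?thesis by simp
qed

lemma rec_diff:
  assumes "total_rec f" "total_rec g"
  shows "total_rec (\<lambda>e. f e - g e)"
proof -
  have "total_rec (\<lambda>e. rec_nat 0 (\<lambda>i _. i) (f e))" if "total_rec f" for f
    by (intro rec_primrec that tr_const rec_fst rec_snd tr_id)
  moreover have "rec_nat 0 (\<lambda>i _. i) b = b - 1" for b :: nat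
    by (cases b) auto
  ultimately have pred: "total_rec (\<lambda>e. f e - 1)" if "total_rec f" for f
    using that by simp
  have "total_rec (\<lambda>e. rec_nat (f e) (\<lambda>_ r. r - 1) (g e))"
    by (intro rec_primrec assms pred rec_fst rec_snd tr_id)
  moreover have "rec_nat a (\<lambda>_ r. r - 1) b = a - b" for a b :: nat
    by (induction b) auto
  ultimately show ?thesis by simp
qed

lemma rec_sum:
  assumes "total_rec n"
    and "total_rec (\<lambda>z. g (fst (prod_decode z)) (snd (prod_decode z)))"
  shows "total_rec (\<lambda>e. \<Sum>i<n e. g e i)"
proof -
  have "total_rec (\<lambda>e. rec_nat 0 (\<lambda>i r. r + g e i) (n e))"
    by (intro rec_primrec assms(1) tr_const rec_add rec_comp2[OF assms(2)] rec_fst rec_snd tr_id)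
  moreover have "rec_nat 0 (\<lambda>i r. r + h i) b = (\<Sum>i<b. h i)" for h :: "nat \<Rightarrow> nat" and b
    by (induction b) auto
  ultimately show ?thesis by simp
qed

lemma rec_not:
  assumes "total_rec (\<lambda>e. of_bool (P e))"
  shows "total_rec (\<lambda>e. of_bool (\<not> P e))"
proof -
  have "(\<lambda>e. of_bool (\<not> P e)) = (\<lambda>e. 1 - of_bool (P e) :: nat)" by auto
  with rec_diff[OF tr_const[of 1] assms] show ?thesis by simp
qed

lemma rec_conj:
  assumes "total_rec (\<lambda>e. of_bool (P e))" "total_rec (\<lambda>e. of_bool (Q e))"
  shows "total_rec (\<lambda>e. of_bool (P e \<and> Q e))"
  using rec_mult[OF assms] by (simp add: of_bool_conj)

lemma rec_disj:
  assumes "total_rec (\<lambda>e. of_bool (P e))" "total_rec (\<lambda>e. of_bool (Q e))"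
  shows "total_rec (\<lambda>e. of_bool (P e \<or> Q e))"
  using rec_not[OF rec_conj[OF rec_not rec_not, OF assms]] by simp

lemma rec_imp:
  assumes "total_rec (\<lambda>e. of_bool (P e))" "total_rec (\<lambda>e. of_bool (Q e))"
  shows "total_rec (\<lambda>e. of_bool (P e \<longrightarrow> Q e))"
  using rec_disj[OF rec_not, OF assms] by (simp only: imp_conv_disj)

lemma rec_iff:
  assumes "total_rec (\<lambda>e. of_bool (P e))" "total_rec (\<lambda>e. of_bool (Q e))"
  shows "total_rec (\<lambda>e. of_bool (P e \<longleftrightarrow> Q e))"
  using rec_conj[OF rec_imp[OF assms] rec_imp[OF assms(2,1)]]
  by (simp only: iff_conv_conj_imp)

lemma rec_less:
  assumes "total_rec f" "total_rec g"
  shows "total_rec (\<lambda>e. of_bool (f e < g e))"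
proof -
  have "(\<lambda>e. of_bool (f e < g e)) = (\<lambda>e. 1 - (1 - (g e - f e)))" by auto
  then show ?thesis by (simp only:) (intro rec_diff tr_const assms)
qed

lemma rec_le:
  assumes "total_rec f" "total_rec g"
  shows "total_rec (\<lambda>e. of_bool (f e \<le> g e))"
  using rec_not[OF rec_less[OF assms(2,1)]] by (simp add: not_less)

lemma rec_eq:
  assumes "total_rec f" "total_rec g"
  shows "total_rec (\<lambda>e. of_bool (f e = g e))"
  using rec_conj[OF rec_le[OF assms] rec_le[OF assms(2,1)]] by (simp add: order_eq_iff)

lemma rec_ex:
  assumes "total_rec n"
    and "total_rec (\<lambda>z. of_bool (P (fst (prod_decode z)) (snd (prod_decode z))))"
  shows "total_rec (\<lambda>e. of_bool (\<exists>i<n e. P e i))"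
proof -
  have "total_rec (\<lambda>e. of_bool (0 < (\<Sum>i<n e. of_bool (P e i) :: nat)))"
    by (intro rec_less tr_const rec_sum assms)
  moreover have "0 < (\<Sum>i<b. of_bool (Q i) :: nat) \<longleftrightarrow> (\<exists>i<b. Q i)" for Q and b :: nat
    by (induction b) (auto simp: less_Suc_eq)
  ultimately show ?thesis by simp
qed

lemma rec_all:
  assumes "total_rec n"
    and "total_rec (\<lambda>z. of_bool (P (fst (prod_decode z)) (snd (prod_decode z))))"
  shows "total_rec (\<lambda>e. of_bool (\<forall>i<n e. P e i))"
  using rec_not[OF rec_ex[OF assms(1) rec_not[OF assms(2)]]] by simp

lemma rec_if:
  assumes "total_rec (\<lambda>e. of_bool (P e))" "total_rec f" "total_rec g"
  shows "total_rec (\<lambda>e. if P e then f e else g e)"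
proof -
  have "(\<lambda>e. if P e then f e else g e) = (\<lambda>e. of_bool (P e) * f e + of_bool (\<not> P e) * g e)"
    by auto
  then show ?thesis by (simp only:) (intro rec_add rec_mult rec_not assms)
qed

lemma rec_div:
  assumes "total_rec f" "total_rec g"
  shows "total_rec (\<lambda>e. f e div g e)"
proof -
  \<comment> \<open>The quotient counts the positive multiples of the divisor that do not exceed the
    dividend; the factor \<open>of_bool (0 < g e)\<close> reproduces
    \<open>a div 0 = 0\<close>.\<close>
  have "total_rec (\<lambda>e. of_bool (0 < g e) * (\<Sum>i<f e. of_bool (Suc i * g e \<le> f e)))"
    by (intro rec_mult rec_less tr_const rec_sum rec_le rec_Suc rec_snd rec_fst tr_id assms
        tr_comp[OF assms(1)] tr_comp[OF assms(2)])
  moreover have "of_bool (0 < b) * (\<Sum>i<a. of_bool (Suc i * b \<le> a)) = a div b" for a b :: nat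
  proof (cases "b = 0")
    case False
    have "i < a \<and> Suc i * b \<le> a \<longleftrightarrow> i < a div b" for i
      using False by (metis Suc_le_eq div_le_dividend less_eq_div_iff_mult_less_eq
          neq0_conv order_less_le_trans)
    then have "{..<a} \<inter> {i. Suc i * b \<le> a} = {..<a div b}" by auto
    moreover have "(\<Sum>i<a. of_bool (Suc i * b \<le> a)) = card ({..<a} \<inter> {i. Suc i * b \<le> a})"
      by (simp add: of_bool_def flip: sum.inter_filter) (simp add: Collect_conj_eq lessThan_def)
    ultimately show ?thesis using False by simp
  qed simp
  ultimately show ?thesis by simp
qed

lemma rec_mod:
  assumes "total_rec f" "total_rec g"
  shows "total_rec (\<lambda>e. f e mod g e)"
  unfolding minus_div_mult_eq_mod[symmetric] by (intro rec_diff rec_mult rec_div assms)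

lemma rec_odd:
  assumes "total_rec f"
  shows "total_rec (\<lambda>e. of_bool (odd (f e)))"
  unfolding odd_iff_mod_2_eq_one by (intro rec_eq rec_mod assms tr_const)

lemma rec_Least:
  assumes "total_rec (\<lambda>z. of_bool (P (fst (prod_decode z)) (snd (prod_decode z))))"
    and "\<And>e. \<exists>y. P e y"
  shows "total_rec (\<lambda>e. LEAST y. P e y)"
  using tr_mu[OF rec_not[OF assms(1)]] assms(2) by simp

lemmas rec_intros = tr_const tr_id rec_pair rec_fst rec_snd rec_Suc rec_add rec_mult rec_power
  rec_diff rec_sum rec_not rec_conj rec_disj rec_imp rec_iff rec_less rec_le rec_eq rec_ex rec_all
  rec_if rec_div rec_mod rec_odd

section \<open>Finite sets and lists coded as numbers\<close>

lemma less_of_mem_set_decode: "y \<in> set_decode c \<Longrightarrow> y < c"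
  by (metis div_less even_zero less_exp linorder_not_less mem_Collect_eq order_le_less_trans
      set_decode_def)

lemma rec_mem_set_decode:
  assumes "total_rec f" "total_rec g"
  shows "total_rec (\<lambda>e. of_bool (f e \<in> set_decode (g e)))"
  unfolding set_decode_def mem_Collect_eq by (intro rec_intros assms)

lemma rec_subset_set_decode:
  assumes "total_rec f" "total_rec g"
  shows "total_rec (\<lambda>e. of_bool (set_decode (f e) \<subseteq> set_decode (g e)))"
proof -
  \<comment> \<open>Elements of a decoded set are smaller than its code, so a bounded quantifier
    suffices.\<close>
  have "total_rec (\<lambda>e. of_bool (\<forall>y<f e. y \<in> set_decode (f e) \<longrightarrow> y \<in> set_decode (g e)))"
    by (intro rec_intros rec_mem_set_decode assms assms[THEN tr_comp])
  moreover have "set_decode a \<subseteq> set_decode b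
      \<longleftrightarrow> (\<forall>y<a. y \<in> set_decode a \<longrightarrow> y \<in> set_decode b)" for a b
    using less_of_mem_set_decode by auto
  ultimately show ?thesis by simp
qed

lemma rec_set_encode:
  assumes "total_rec n"
    and "total_rec (\<lambda>z. of_bool (P (fst (prod_decode z)) (snd (prod_decode z))))"
  shows "total_rec (\<lambda>e. set_encode {v. v < n e \<and> P e v})"
proof -
  have "total_rec (\<lambda>e. \<Sum>v<n e. of_bool (P e v) * 2 ^ v)"
    by (intro rec_intros assms)
  moreover have "(\<Sum>v<b. of_bool (Q v) * 2 ^ v) = set_encode {v. v < b \<and> Q v}" for Q and b :: nat
    unfolding set_encode_def by (rule sum.mono_neutral_cong_right) auto
  ultimately show ?thesis by simp
qed

lemma rec_card:
  assumes "total_rec n"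
    and "total_rec (\<lambda>z. of_bool (P (fst (prod_decode z)) (snd (prod_decode z))))"
  shows "total_rec (\<lambda>e. card {v. v < n e \<and> P e v})"
proof -
  have "total_rec (\<lambda>e. \<Sum>v<n e. of_bool (P e v))"
    by (intro rec_intros assms)
  moreover have "(\<Sum>v<b. of_bool (Q v)) = card {v. v < b \<and> Q v}" for Q and b :: nat
    unfolding card_eq_sum by (rule sum.mono_neutral_cong_right) auto
  ultimately show ?thesis by simp
qed

text \<open>A nonempty list has code \<open>Suc (prod_encode (head, tail code))\<close>; hence
  \<open>r - 1\<close> undoes the successor and the second projection is the tail.\<close>

definition nth_code :: "nat \<Rightarrow> nat \<Rightarrow> nat" where
  "nth_code u i = fst (prod_decode (rec_nat u (\<lambda>_ r. snd (prod_decode (r - 1))) i - 1))"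

text \<open>Beyond the end of the list the value is \<^term>\<open>0::nat\<close>, since \<^term>\<open>0::nat\<close> codes both the
  empty list and the pair of zeros.\<close>

lemma nth_code_list_encode:
  "nth_code (list_encode xs) i = (if i < length xs then xs ! i else 0)"
proof -
  have 0: "prod_decode 0 = (0, 0)"
    using prod_encode_inverse[of "(0, 0)"] by (simp add: prod_encode_def)
  have "rec_nat (list_encode xs) (\<lambda>_ r. snd (prod_decode (r - 1))) i = list_encode (drop i xs)"
  proof (induction i)
    case (Suc i)
    show ?case
    proof (cases "drop i xs")
      case Nil
      with Suc 0 show ?thesis by (simp add: drop_Suc drop_tl)
    next
      case (Cons y ys)
      then have "drop (Suc i) xs = ys" by (metis drop_Suc list.sel(3) tl_drop)
      with Suc Cons show ?thesis by simp
    qed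
  qed simp
  then have *: "nth_code (list_encode xs) i = fst (prod_decode (list_encode (drop i xs) - 1))"
    by (simp add: nth_code_def)
  show ?thesis
  proof (cases "i < length xs")
    case True
    then show ?thesis unfolding * by (simp flip: Cons_nth_drop_Suc)
  next
    case False
    then show ?thesis unfolding * using 0 by simp
  qed
qed

lemma rec_nth_code:
  assumes "total_rec f" "total_rec g"
  shows "total_rec (\<lambda>e. nth_code (f e) (g e))"
  unfolding nth_code_def by (intro rec_intros rec_primrec assms)

lemma rec_tabulate:
  assumes "total_rec n"
    and "total_rec (\<lambda>z. g (fst (prod_decode z)) (snd (prod_decode z)))"
  shows "total_rec (\<lambda>e. list_encode (map (g e) [0..<n e]))"
proof -
  \<comment> \<open>The list grows from the back, since coding prepends: after \<open>j\<close>
    rounds the accumulator codes the last \<open>j\<close> entries.\<close>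
  have "total_rec (\<lambda>e. rec_nat 0 (\<lambda>j r. Suc (prod_encode (g e (n e - 1 - j), r))) (n e))"
    by (intro rec_intros rec_primrec assms(1) rec_comp2[OF assms(2)] tr_comp[OF assms(1)])
  moreover have "rec_nat 0 (\<lambda>j r. Suc (prod_encode (h (b - 1 - j), r))) j
      = list_encode (map h [b - j..<b])" if "j \<le> b" for h j and b :: nat
    using that
  proof (induction j)
    case (Suc j)
    then have "[b - Suc j..<b] = (b - Suc j) # [b - j..<b]"
      by (metis Suc_diff_Suc Suc_le_lessD upt_conv_Cons diff_less zero_less_Suc less_le_trans)
    with Suc show ?case by simp
  qed simp
  ultimately show ?thesis by simp
qed

lemmas rec_code_intros = rec_intros rec_mem_set_decode rec_subset_set_decode rec_set_encode rec_card
  rec_nth_code rec_tabulate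

section \<open>The strategy\<close>

text \<open>A token (program) is a record of its level, the code of the set enumerated so far, and a
  clopen set of random sequences, given by a length and the code of a set of prefixes of this
  length (binary, least significant bit first).\<close>

definition token :: "nat \<Rightarrow> nat \<Rightarrow> nat \<Rightarrow> nat \<Rightarrow> nat" where
  "token l F t C = prod_encode (l, prod_encode (F, prod_encode (t, C)))"

definition level :: "nat \<Rightarrow> nat" where
  "level r = fst (prod_decode r)"

definition enumerated :: "nat \<Rightarrow> nat" where
  "enumerated r = fst (prod_decode (snd (prod_decode r)))"

definition time :: "nat \<Rightarrow> nat" where
  "time r = fst (prod_decode (snd (prod_decode (snd (prod_decode r)))))"

definition cylinders :: "nat \<Rightarrow> nat" where
  "cylinders r = snd (prod_decode (snd (prod_decode (snd (prod_decode r)))))"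

lemma token_simps [simp]:
  "level (token l F t C) = l" "enumerated (token l F t C) = F"
  "time (token l F t C) = t" "cylinders (token l F t C) = C"
  by (simp_all add: token_def level_def enumerated_def time_def cylinders_def)

text \<open>The initial level of \<open>p\<close> is \<open>p div 2 ^ k\<close>. The active indices
  form a triangle inside a square of \<open>4 ^ k\<close> indices, so that \<open>2 * k\<close>
  binary digits name a token.\<close>

definition active :: "nat \<Rightarrow> nat \<Rightarrow> bool" where
  "active k p \<longleftrightarrow> p < 4 ^ k \<and> p div 2 ^ k + p mod 2 ^ k < 2 ^ k"

text \<open>The stage number itself codes the request: bound, target and a free padding component.
  The padding makes every request recur at arbitrarily late stages.\<close>

definition bound :: "nat \<Rightarrow> nat" where
  "bound s = fst (prod_decode (fst (prod_decode s)))"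

definition target :: "nat \<Rightarrow> nat" where
  "target s = snd (prod_decode (fst (prod_decode s)))"

definition usable :: "nat \<Rightarrow> nat \<Rightarrow> nat \<Rightarrow> nat \<Rightarrow> bool" where
  "usable k s u p \<longleftrightarrow> active k p \<and> set_decode (enumerated (nth_code u p)) \<subseteq> set_decode (target s)"

definition chosen :: "nat \<Rightarrow> nat \<Rightarrow> nat \<Rightarrow> nat \<Rightarrow> bool" where
  "chosen k s u p \<longleftrightarrow> usable k s u p \<and>
     (\<forall>q<4^k. usable k s u q \<longrightarrow> level (nth_code u q) < level (nth_code u p) \<or>
        level (nth_code u q) = level (nth_code u p) \<and> p \<le> q)"

locale enumerator =
  fixes f :: "nat \<Rightarrow> nat"
  assumes f: "total_rec f"
begin

text \<open>\<open>f\<close> computes a probabilistic machine as in \<open>prob_machine\<close>: the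
  value \<open>Suc y\<close> means output \<open>y\<close>, and 0 means no output. The binary digits
  of \<open>v\<close> act as the random bits.\<close>

definition outs :: "nat \<Rightarrow> nat \<Rightarrow> nat set" where
  "outs v t = {y. \<exists>n<Suc t. f (list_encode (map (\<lambda>i. of_bool (odd (v div 2 ^ i))) [0..<n])) = Suc y}"

text \<open>The reduction modulo a power of two cuts the prefix \<open>v\<close> down to the length
  in which the token's remembered set is described.\<close>

definition cand :: "nat \<Rightarrow> nat \<Rightarrow> nat \<Rightarrow> nat \<Rightarrow> bool" where
  "cand k s u v \<longleftrightarrow> outs v s \<inter> {..<bound s} = set_decode (target s) \<and>
     (\<forall>q<4^k. active k q \<and> \<not> usable k s u q \<longrightarrow>
        v mod 2 ^ time (nth_code u q) \<notin> set_decode (cylinders (nth_code u q)))"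

text \<open>Measure at least \<open>1 / 2 ^ k\<close>, cleared of denominators to keep the test
  within the natural numbers.\<close>

definition heavy :: "nat \<Rightarrow> nat \<Rightarrow> nat \<Rightarrow> bool" where
  "heavy k s u \<longleftrightarrow> 2 ^ s \<le> card {v. v < 2 ^ s \<and> cand k s u v} * 2 ^ k"

text \<open>The chosen token serves the request; its level \<open>j\<close> and level \<open>j + 1\<close> are swapped for all other
  tokens.\<close>

definition move :: "nat \<Rightarrow> nat \<Rightarrow> nat \<Rightarrow> nat \<Rightarrow> nat" where
  "move k s u p = (if \<not> heavy k s u then nth_code u p
     else if chosen k s u p then
       token (level (nth_code u p)) (target s) s (set_encode {v. v < 2 ^ s \<and> cand k s u v})
     else if \<exists>q<4^k. chosen k s u q \<and> level (nth_code u p) = level (nth_code u q) then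
       token (level (nth_code u p) + 1) (enumerated (nth_code u p)) (time (nth_code u p))
         (cylinders (nth_code u p))
     else if \<exists>q<4^k. chosen k s u q \<and> level (nth_code u p) = level (nth_code u q) + 1 then
       token (level (nth_code u p) - 1) (enumerated (nth_code u p)) (time (nth_code u p))
         (cylinders (nth_code u p))
     else nth_code u p)"

definition state :: "nat \<Rightarrow> nat \<Rightarrow> nat" where
  "state k s = rec_nat (list_encode (map (\<lambda>p. token (p div 2 ^ k) 0 0 0) [0..<4^k]))
     (\<lambda>s u. list_encode (map (move k s u) [0..<4^k])) s"

section \<open>Computability of the strategy\<close>

lemma rec_token_parts:
  assumes "total_rec g"
  shows "total_rec (\<lambda>e. level (g e))" "total_rec (\<lambda>e. enumerated (g e))"
    "total_rec (\<lambda>e. time (g e))" "total_rec (\<lambda>e. cylinders (g e))"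
    "total_rec (\<lambda>e. bound (g e))" "total_rec (\<lambda>e. target (g e))"
  unfolding level_def enumerated_def time_def cylinders_def bound_def target_def
  by (intro rec_intros assms)+

lemma rec_token:
  assumes "total_rec a" "total_rec b" "total_rec c" "total_rec d"
  shows "total_rec (\<lambda>e. token (a e) (b e) (c e) (d e))"
  unfolding token_def by (intro rec_intros assms)

lemma rec_active:
  assumes "total_rec a" "total_rec b"
  shows "total_rec (\<lambda>e. of_bool (active (a e) (b e)))"
  unfolding active_def by (intro rec_intros assms)

lemma rec_usable:
  assumes "total_rec a" "total_rec b" "total_rec c" "total_rec d"
  shows "total_rec (\<lambda>e. of_bool (usable (a e) (b e) (c e) (d e)))"
  unfolding usable_def by (intro rec_code_intros rec_active rec_token_parts assms)

lemma rec_chosen: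
  assumes "total_rec a" "total_rec b" "total_rec c" "total_rec d"
  shows "total_rec (\<lambda>e. of_bool (chosen (a e) (b e) (c e) (d e)))"
  unfolding chosen_def
  by (intro rec_code_intros rec_usable rec_token_parts assms assms[THEN tr_comp])

lemma rec_mem_outs:
  assumes "total_rec a" "total_rec b" "total_rec c"
  shows "total_rec (\<lambda>e. of_bool (c e \<in> outs (a e) (b e)))"
  unfolding outs_def mem_Collect_eq
  by (intro rec_code_intros tr_comp[OF f] assms assms[THEN tr_comp])

lemma rec_cand:
  assumes "total_rec a" "total_rec b" "total_rec c" "total_rec d"
  shows "total_rec (\<lambda>e. of_bool (cand (a e) (b e) (c e) (d e)))"
proof -
  \<comment> \<open>Set equality becomes bounded quantification: below \<open>m\<close> for the left
    set, below the code \<open>T\<close> for the decoded one.\<close>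
  have eq: "A \<inter> {..<m} = set_decode T
      \<longleftrightarrow> (\<forall>y<m. y \<in> A \<longleftrightarrow> y \<in> set_decode T) \<and> (\<forall>y<T. y \<in> set_decode T \<longrightarrow> y < m)" for A m T
    using less_of_mem_set_decode by blast
  show ?thesis unfolding cand_def eq
    by (intro rec_code_intros rec_active rec_usable rec_mem_outs rec_token_parts assms
        assms[THEN tr_comp])
qed

lemma rec_heavy:
  assumes "total_rec a" "total_rec b" "total_rec c"
  shows "total_rec (\<lambda>e. of_bool (heavy (a e) (b e) (c e)))"
  unfolding heavy_def
  by (intro rec_code_intros rec_cand assms assms[THEN tr_comp])

lemma rec_move:
  assumes "total_rec a" "total_rec b" "total_rec c" "total_rec d"
  shows "total_rec (\<lambda>e. move (a e) (b e) (c e) (d e))"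
  unfolding move_def
  by (intro rec_code_intros rec_heavy rec_chosen rec_cand rec_token rec_token_parts assms
      assms[THEN tr_comp])

lemma rec_state:
  assumes "total_rec a" "total_rec b"
  shows "total_rec (\<lambda>e. state (a e) (b e))"
  unfolding state_def
  by (intro rec_code_intros rec_primrec rec_move rec_token assms assms[THEN tr_comp])

end

section \<open>The uniform measure on the Cantor space\<close>

text \<open>With the least significant bit first, passing to a shorter prefix is reduction modulo a
  power of two.\<close>

definition prefix_code :: "(nat \<Rightarrow> bool) \<Rightarrow> nat \<Rightarrow> nat" where
  "prefix_code w t = horner_sum of_bool 2 (map w [0..<t])"

lemma prefix_code_less: "prefix_code w t < 2 ^ t"
  using horner_sum_of_bool_2_less[of "map w [0..<t]"] by (simp add: prefix_code_def)

lemma odd_prefix_code: "odd (prefix_code w t div 2 ^ i) \<longleftrightarrow> i < t \<and> w i"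
  unfolding prefix_code_def bit_iff_odd[symmetric] by (auto simp: bit_horner_sum_bit_iff)

lemma prefix_code_mod:
  assumes "n \<le> t"
  shows "prefix_code w t mod 2 ^ n = prefix_code w n"
  using assms take_bit_horner_sum_bit_eq[of n "map w [0..<t]"]
  by (simp add: prefix_code_def take_bit_eq_mod take_map)

lemma prefix_code_eq_iff:
  assumes "v < 2 ^ t"
  shows "prefix_code w t = v \<longleftrightarrow> (\<forall>i<t. w i \<longleftrightarrow> odd (v div 2 ^ i))"
proof
  assume r: "\<forall>i<t. w i \<longleftrightarrow> odd (v div 2 ^ i)"
  have "\<not> odd (v div 2 ^ i)" if "t \<le> i" for i
    using order_less_le_trans[OF assms, of "2 ^ i"] that by simp
  then show "prefix_code w t = v"
    unfolding bit_eq_iff bit_iff_odd odd_prefix_code using r by (meson not_less)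
qed (use odd_prefix_code in blast)

interpretation cantor: product_prob_space "\<lambda>_. measure_pmf (bernoulli_pmf (1/2))" UNIV
  by unfold_locales

lemma prob_space_cantor: "prob_space cantor"
  unfolding cantor_def by (rule cantor.prob_space_axioms)

lemma space_cantor [simp]: "space cantor = UNIV"
  by (simp add: cantor_def space_PiM)

lemma measure_prefix_code_eq:
  assumes "v < 2 ^ t"
  shows "{w. prefix_code w t = v} \<in> sets cantor \<and> measure cantor {w. prefix_code w t = v} = 1 / 2 ^ t"
proof -
  define X where "X i = {odd (v div 2 ^ i)}" for i
  have eq: "{w. prefix_code w t = v} = {w \<in> space cantor. \<forall>i\<in>{..<t}. w i \<in> X i}"
    by (auto simp: prefix_code_eq_iff[OF assms] X_def)
  have half: "measure_pmf.prob (bernoulli_pmf (1/2)) (X i) = 1/2" for i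
    by (cases "odd (v div 2 ^ i)") (simp_all add: X_def measure_pmf_single)
  have "emeasure cantor {w. prefix_code w t = v}
      = (\<Prod>i<t. emeasure (measure_pmf (bernoulli_pmf (1/2))) (X i))"
    unfolding eq unfolding cantor_def by (subst cantor.emeasure_PiM_Collect) auto
  also have "\<dots> = (\<Prod>i<t. ennreal (1/2))"
    by (simp only: measure_pmf.emeasure_eq_measure half)
  also have "\<dots> = ennreal (1 / 2 ^ t)"
    by (subst prod_ennreal) (simp_all add: power_one_over)
  finally have "measure cantor {w. prefix_code w t = v} = 1 / 2 ^ t"
    by (simp add: measure_def)
  moreover have "{w. prefix_code w t = v} \<in> sets cantor"
    unfolding eq unfolding cantor_def by measurable
  ultimately show ?thesis by simp
qed

lemma measurable_prefix_code: "(\<lambda>w. prefix_code w t) \<in> measurable cantor (count_space UNIV)"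
proof (subst measurable_count_space_eq2_countable, intro conjI ballI)
  fix v :: nat
  have "(\<lambda>w. prefix_code w t) -` {v} \<inter> space cantor
      = (if v < 2 ^ t then {w. prefix_code w t = v} else {})"
    using prefix_code_less by auto
  then show "(\<lambda>w. prefix_code w t) -` {v} \<inter> space cantor \<in> sets cantor"
    using measure_prefix_code_eq by simp
qed auto

lemma sets_prefix_code: "{w. P (prefix_code w t)} \<in> sets cantor"
  using measurable_sets[OF measurable_prefix_code, of "Collect P" t] by (simp add: vimage_def)

text \<open>An event determined by the first \<open>t\<close> bits is a disjoint union of cylinders
  of measure \<open>1 / 2 ^ t\<close>. This links the counting test \<open>heavy\<close> to the
  measure.\<close>

lemma measure_prefix_code:
  "measure cantor {w. P (prefix_code w t)} = card {v. v < 2 ^ t \<and> P v} / 2 ^ t"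
proof -
  interpret prob_space cantor by (rule prob_space_cantor)
  let ?V = "{v. v < 2 ^ t \<and> P v}"
  have "{w. P (prefix_code w t)} = (\<Union>v\<in>?V. {w. prefix_code w t = v})"
    using prefix_code_less by auto
  then have "measure cantor {w. P (prefix_code w t)}
      = (\<Sum>v\<in>?V. measure cantor {w. prefix_code w t = v})"
    using measure_prefix_code_eq
    by (subst finite_measure_finite_Union[symmetric])
      (auto simp: disjoint_family_on_def image_subset_iff)
  also have "\<dots> = (\<Sum>v\<in>?V. 1 / 2 ^ t)"
    by (rule sum.cong) (auto simp: measure_prefix_code_eq)
  finally show ?thesis by simp
qed

context enumerator
begin

section \<open>Invariants of the strategy\<close>

definition run :: "(nat \<Rightarrow> bool) \<Rightarrow> nat \<Rightarrow> nat set" where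
  "run w t = {y. \<exists>n<Suc t. f (enc_str (prefix n w)) = Suc y}"

definition result :: "(nat \<Rightarrow> bool) \<Rightarrow> nat set" where
  "result w = {y. \<exists>n. f (enc_str (prefix n w)) = Suc y}"

lemma run_mono: "t \<le> t' \<Longrightarrow> run w t \<subseteq> run w t'"
  unfolding run_def by (auto intro: less_le_trans)

lemma run_subset_result: "run w t \<subseteq> result w"
  unfolding run_def result_def by auto

lemma result_eq_Union: "result w = (\<Union>t. run w t)"
  unfolding run_def result_def by auto

lemma outs_prefix_code: "outs (prefix_code w t) t = run w t"
proof -
  \<comment> \<open>Only strings of length at most \<open>t\<close> are consulted, so the zero
    digits of the code from position \<open>t\<close> on never stand in for random bits.\<close>
  have eq: "map (\<lambda>i. of_bool (odd (prefix_code w t div 2 ^ i))) [0..<n] = map of_bool (prefix n w)"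
    if "n < Suc t" for n
    using that by (auto simp: prefix_def odd_prefix_code)
  have "n < Suc t \<and> f (list_encode (map (\<lambda>i. of_bool (odd (prefix_code w t div 2 ^ i))) [0..<n])) = Suc y
      \<longleftrightarrow> n < Suc t \<and> f (enc_str (prefix n w)) = Suc y" for n y
    by (rule conj_cong) (simp_all only: eq enc_str_def)
  then show ?thesis
    unfolding outs_def run_def by simp
qed

definition tok :: "nat \<Rightarrow> nat \<Rightarrow> nat \<Rightarrow> nat" where
  "tok k s p = nth_code (state k s) p"

definition enum_set :: "nat \<Rightarrow> nat \<Rightarrow> nat \<Rightarrow> nat set" where
  "enum_set k s p = set_decode (enumerated (tok k s p))"

definition clopen :: "nat \<Rightarrow> nat \<Rightarrow> nat \<Rightarrow> (nat \<Rightarrow> bool) set" where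
  "clopen k s p = {w. prefix_code w (time (tok k s p)) \<in> set_decode (cylinders (tok k s p))}"

definition request :: "nat \<Rightarrow> nat \<Rightarrow> (nat \<Rightarrow> bool) set" where
  "request k s = {w. cand k s (state k s) (prefix_code w s)}"

section \<open>The effect of one stage on the tokens\<close>

lemma tok_0: "p < 4 ^ k \<Longrightarrow> tok k 0 p = token (p div 2 ^ k) 0 0 0"
  by (simp add: tok_def state_def nth_code_list_encode)

lemma tok_Suc: "p < 4 ^ k \<Longrightarrow> tok k (Suc s) p = move k s (state k s) p"
  by (simp add: tok_def state_def nth_code_list_encode)

lemma activeD: "active k p \<Longrightarrow> p < 4 ^ k"
  by (simp add: active_def)

lemma usable_iff:
  "usable k s (state k s) p \<longleftrightarrow> active k p \<and> enum_set k s p \<subseteq> set_decode (target s)"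
  by (simp add: usable_def enum_set_def tok_def)

lemma chosen_usable: "chosen k s u c \<Longrightarrow> usable k s u c"
  by (simp add: chosen_def)

lemma chosen_active: "chosen k s u c \<Longrightarrow> active k c"
  by (simp add: chosen_def usable_def)

lemma chosen_unique: "chosen k s u c \<Longrightarrow> chosen k s u d \<Longrightarrow> c = d"
proof -
  have "level (nth_code u q) < level (nth_code u p) \<or> level (nth_code u q) = level (nth_code u p) \<and> p \<le> q"
    if "chosen k s u p" "chosen k s u q" for p q
    using that chosen_usable[OF that(2)] activeD[OF chosen_active[OF that(2)]]
    unfolding chosen_def[of k s u p] by blast
  from this[of c d] this[of d c] show "c = d" if "chosen k s u c" "chosen k s u d"
    using that by fastforce
qed

lemma ex_chosen:
  assumes "usable k s u p"
  shows "\<exists>c. chosen k s u c"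
proof -
  define L where "L = Max ((\<lambda>p. level (nth_code u p)) ` {p. usable k s u p})"
  have "finite {p. usable k s u p}"
    by (rule finite_subset[of _ "{..<4^k}"]) (auto simp: usable_def activeD)
  then have L: "L \<in> (\<lambda>p. level (nth_code u p)) ` {p. usable k s u p}"
    and le: "\<And>q. usable k s u q \<Longrightarrow> level (nth_code u q) \<le> L"
    using assms unfolding L_def by (auto intro!: Max_in Max_ge)
  define c where "c = (LEAST c. usable k s u c \<and> level (nth_code u c) = L)"
  obtain r where "usable k s u r \<and> level (nth_code u r) = L"
    using L by blast
  then have "usable k s u c \<and> level (nth_code u c) = L"
    unfolding c_def by (rule LeastI)
  moreover have "c \<le> q" if "usable k s u q" "level (nth_code u q) = L" for q
    unfolding c_def using that by (intro Least_le) auto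
  ultimately have "chosen k s u c"
    unfolding chosen_def using le by (metis le_neq_implies_less)
  then show ?thesis ..
qed

lemma tok_idle:
  assumes "p < 4 ^ k" "\<not> heavy k s (state k s) \<or> \<not> (\<exists>c. chosen k s (state k s) c)"
  shows "tok k (Suc s) p = tok k s p"
  using assms unfolding tok_Suc[OF assms(1)] move_def tok_def[symmetric] by auto

lemma tok_chosen:
  assumes "heavy k s (state k s)" "chosen k s (state k s) c"
  shows "level (tok k (Suc s) c) = level (tok k s c)"
    and "enum_set k (Suc s) c = set_decode (target s)"
    and "time (tok k (Suc s) c) = s"
    and "clopen k (Suc s) c = request k s"
proof -
  have c: "c < 4 ^ k" using assms(2) by (simp add: chosen_active activeD)
  have *: "tok k (Suc s) c = token (level (tok k s c)) (target s) s
      (set_encode {v. v < 2 ^ s \<and> cand k s (state k s) v})"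
    unfolding tok_Suc[OF c] move_def tok_def[symmetric] using assms by simp
  show "level (tok k (Suc s) c) = level (tok k s c)"
    "enum_set k (Suc s) c = set_decode (target s)" "time (tok k (Suc s) c) = s"
    by (simp_all add: * enum_set_def)
  show "clopen k (Suc s) c = request k s"
    by (simp add: * clopen_def request_def prefix_code_less)
qed

text \<open>Written as a transposition, the level change is visibly injective: two tokens other than
  \<open>c\<close> share a level after the stage only if they did before.\<close>

lemma tok_other:
  assumes "heavy k s (state k s)" "chosen k s (state k s) c" "p < 4 ^ k" "p \<noteq> c"
  shows "level (tok k (Suc s) p) = Transposition.transpose (level (tok k s c)) (Suc (level (tok k s c))) (level (tok k s p))"
    and "enum_set k (Suc s) p = enum_set k s p"
    and "time (tok k (Suc s) p) = time (tok k s p)"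
    and "clopen k (Suc s) p = clopen k s p"
proof -
  have nc: "\<not> chosen k s (state k s) p" using assms chosen_unique by blast
  have ex: "(\<exists>q<4^k. chosen k s (state k s) q \<and> P q) \<longleftrightarrow> P c" for P
    using assms(2) chosen_unique activeD[OF chosen_active[OF assms(2)]] by blast
  have *: "tok k (Suc s) p =
    (if level (tok k s p) = level (tok k s c) then
       token (level (tok k s p) + 1) (enumerated (tok k s p)) (time (tok k s p)) (cylinders (tok k s p))
     else if level (tok k s p) = level (tok k s c) + 1 then
       token (level (tok k s p) - 1) (enumerated (tok k s p)) (time (tok k s p)) (cylinders (tok k s p))
     else tok k s p)"
    unfolding tok_Suc[OF assms(3)] move_def tok_def[symmetric] ex using assms(1) nc by simp
  show "level (tok k (Suc s) p) = Transposition.transpose (level (tok k s c)) (Suc (level (tok k s c))) (level (tok k s p))"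
    "enum_set k (Suc s) p = enum_set k s p"
    "time (tok k (Suc s) p) = time (tok k s p)"
    "clopen k (Suc s) p = clopen k s p"
    by (simp_all add: * enum_set_def clopen_def Transposition.transpose_def)
qed

lemma step_cases [consumes 1, case_names idle chosen other]:
  assumes "p < 4 ^ k"
  obtains "tok k (Suc s) p = tok k s p"
  | "heavy k s (state k s)" "chosen k s (state k s) p"
  | c where "heavy k s (state k s)" "chosen k s (state k s) c" "p \<noteq> c"
  using assms tok_idle by blast

lemma unchanged:
  assumes "tok k (Suc s) p = tok k s p"
  shows "enum_set k (Suc s) p = enum_set k s p" "clopen k (Suc s) p = clopen k s p"
  using assms by (simp_all add: enum_set_def clopen_def)

lemma time_le: "p < 4 ^ k \<Longrightarrow> time (tok k s p) \<le> s"
proof (induction s)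
  case (Suc s)
  show ?case
    using Suc.prems
  proof (cases rule: step_cases[where s = s])
    case (other c)
    with Suc show ?thesis by (simp add: tok_other le_SucI)
  qed (use Suc in \<open>auto simp: tok_chosen\<close>)
qed (simp add: tok_0)

lemma enum_set_mono_Suc:
  assumes "p < 4 ^ k"
  shows "enum_set k s p \<subseteq> enum_set k (Suc s) p"
  using assms
proof (cases rule: step_cases[where s = s])
  case chosen
  then have "usable k s (state k s) p" by (simp add: chosen_usable)
  with chosen show ?thesis by (simp add: tok_chosen usable_iff)
qed (use assms in \<open>auto simp: tok_other unchanged\<close>)

lemma enum_set_mono:
  assumes "p < 4 ^ k" "s \<le> t"
  shows "enum_set k s p \<subseteq> enum_set k t p"
  using assms(2) lift_Suc_mono_le[of "\<lambda>s. enum_set k s p"] enum_set_mono_Suc[OF assms(1)] by blast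

text \<open>The time stamp is overwritten by the current stage whenever the token serves a request,
  which is the only way its output changes.\<close>

lemma enum_set_unchanged:
  assumes "p < 4 ^ k" "t \<le> s"
  shows "enum_set k s p = enum_set k t p \<or> t \<le> time (tok k s p)"
  using assms(2)
proof (induction s rule: dec_induct)
  case (step s)
  show ?case
    using assms(1)
  proof (cases rule: step_cases[where s = s])
    case chosen
    with step show ?thesis by (simp add: tok_chosen)
  qed (use step assms in \<open>auto simp: tok_other unchanged\<close>)
qed simp

text \<open>Passes from codes of prefixes to sequences and their runs; time stamps never exceed the
  current stage, so a prefix of length \<open>s\<close> decides membership in the remembered
  sets.\<close>

lemma mem_request_iff:
  "w \<in> request k s \<longleftrightarrow> run w s \<inter> {..<bound s} = set_decode (target s) \<and>
     (\<forall>q. active k q \<and> \<not> enum_set k s q \<subseteq> set_decode (target s) \<longrightarrow> w \<notin> clopen k s q)"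
proof -
  have "prefix_code w s mod 2 ^ time (tok k s q) \<in> set_decode (cylinders (tok k s q))
      \<longleftrightarrow> w \<in> clopen k s q" if "q < 4 ^ k" for q
    unfolding clopen_def using prefix_code_mod[OF time_le[OF that]] by simp
  then show ?thesis
    unfolding request_def cand_def mem_Collect_eq outs_prefix_code usable_iff tok_def[symmetric]
    using activeD by blast
qed

lemma heavy_iff: "heavy k s (state k s) \<longleftrightarrow> 1 / 2 ^ k \<le> measure cantor (request k s)"
proof -
  have "heavy k s (state k s) \<longleftrightarrow>
      real (2 ^ s) \<le> real (card {v. v < 2 ^ s \<and> cand k s (state k s) v} * 2 ^ k)"
    unfolding heavy_def of_nat_le_iff ..
  then show ?thesis
    unfolding request_def measure_prefix_code by (simp add: field_simps)
qed

lemma sets_request [simp]: "request k s \<in> sets cantor"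
  unfolding request_def by (rule sets_prefix_code)

lemma sets_clopen [simp]: "clopen k s p \<in> sets cantor"
  unfolding clopen_def by (rule sets_prefix_code)

text \<open>A remembered sequence was a candidate when the token last served, so the token's output
  is the run at that stage cut off at the bound of the request. Initially nothing is
  remembered.\<close>

lemma clopen_run:
  assumes "p < 4 ^ k" "w \<in> clopen k s p"
  shows "\<exists>m. enum_set k s p = run w (time (tok k s p)) \<inter> {..<m}"
  using assms(2)
proof (induction s)
  case 0
  with assms show ?case by (simp add: clopen_def tok_0)
next
  case (Suc s)
  show ?case
    using assms(1)
  proof (cases rule: step_cases[where s = s])
    case chosen
    with Suc.prems have "w \<in> request k s" by (simp add: tok_chosen)
    with chosen show ?thesis unfolding mem_request_iff by (auto simp: tok_chosen)
  qed (use Suc assms in \<open>auto simp: tok_other unchanged\<close>)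
qed

text \<open>Only heavy requests are served, so a token that has output anything remembers a set of
  large measure.\<close>

lemma clopen_measure:
  assumes "p < 4 ^ k"
  shows "enum_set k s p = {} \<or> 1 / 2 ^ k \<le> measure cantor (clopen k s p)"
proof (induction s)
  case 0
  with assms show ?case by (simp add: enum_set_def tok_0)
next
  case (Suc s)
  show ?case
    using assms
  proof (cases rule: step_cases[where s = s])
    case chosen
    then show ?thesis by (simp add: tok_chosen heavy_iff)
  qed (use Suc assms in \<open>auto simp: tok_other unchanged\<close>)
qed

text \<open>The new set of the chosen token could only meet sets of tokens arriving from the next
  higher level. By the maximality of the chosen level these are unusable, and the request avoids
  their sets.\<close>

lemma clopen_disjoint:
  assumes "active k p" "active k q" "p \<noteq> q" "level (tok k s p) = level (tok k s q)"
  shows "clopen k s p \<inter> clopen k s q = {}"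
  using assms
proof (induction s arbitrary: p q)
  case 0
  then show ?case by (simp add: clopen_def tok_0 activeD)
next
  case (Suc s)
  show ?case
  proof (cases "heavy k s (state k s) \<and> (\<exists>c. chosen k s (state k s) c)")
    case False
    then have "tok k (Suc s) p = tok k s p" "tok k (Suc s) q = tok k s q"
      using Suc.prems by (auto intro!: tok_idle activeD)
    with Suc show ?thesis by (simp add: unchanged)
  next
    case True
    then obtain c where h: "heavy k s (state k s)" and c: "chosen k s (state k s) c" by blast
    have new: "request k s \<inter> clopen k s r = {}"
      if "active k r" "r \<noteq> c" "level (tok k (Suc s) r) = level (tok k (Suc s) c)" for r
    proof -
      have "level (tok k s r) = Suc (level (tok k s c))"
        using that tok_other(1)[OF h c activeD] tok_chosen(1)[OF h c]
        by (metis transpose_eq_iff transpose_apply_first)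
      then have "\<not> usable k s (state k s) r"
        using c that(1) activeD[OF that(1)] unfolding chosen_def tok_def by force
      with that show ?thesis unfolding disjoint_iff mem_request_iff usable_iff by blast
    qed
    consider "p = c" | "q = c" | "p \<noteq> c" "q \<noteq> c" by blast
    then show ?thesis
    proof cases
      case 1
      with Suc.prems new[of q] show ?thesis
        by (simp add: tok_chosen[OF h c] tok_other[OF h c] activeD)
    next
      case 2
      with Suc.prems new[of p] show ?thesis
        by (simp add: tok_chosen[OF h c] tok_other[OF h c] activeD Int_commute)
    next
      case 3
      with Suc show ?thesis
        by (metis activeD tok_other(1,4)[OF h c] transpose_involutory)
    qed
  qed
qed

text \<open>Without the chosen token, level \<open>l\<close> has \<open>2 ^ k - l - 1\<close>
  tokens, exactly as many as level \<open>l + 1\<close>, so the swap preserves all sizes.\<close>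

lemma card_level: "card {p. active k p \<and> level (tok k s p) = j} = 2 ^ k - j"
proof (induction s arbitrary: j)
  case 0
  let ?K = "2 ^ k :: nat"
  have K: "(4 :: nat) ^ k = ?K * ?K" by (simp flip: power_mult_distrib)
  have "bij_betw (\<lambda>b. j * ?K + b) {..<?K - j} {p. active k p \<and> level (tok k 0 p) = j}"
  proof (rule bij_betwI[where g = "\<lambda>p. p mod ?K"])
    show "(\<lambda>b. j * ?K + b) \<in> {..<?K - j} \<rightarrow> {p. active k p \<and> level (tok k 0 p) = j}"
    proof
      fix b assume b: "b \<in> {..<?K - j}"
      then have "j * ?K + b < Suc j * ?K" "Suc j * ?K \<le> ?K * ?K"
        using mult_le_mono1[of "Suc j" ?K ?K] by auto
      then have "j * ?K + b < 4 ^ k" unfolding K by linarith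
      moreover have "(j * ?K + b) div ?K = j" "(j * ?K + b) mod ?K = b"
        using b by (auto simp: less_diff_conv)
      ultimately show "j * ?K + b \<in> {p. active k p \<and> level (tok k 0 p) = j}"
        using b by (simp add: active_def tok_0 less_diff_conv add.commute)
    qed
  next
    show "(\<lambda>p. p mod ?K) \<in> {p. active k p \<and> level (tok k 0 p) = j} \<rightarrow> {..<?K - j}"
      by (auto simp: active_def tok_0 less_diff_conv add.commute)
  next
    fix b assume "b \<in> {..<?K - j}"
    then show "(j * ?K + b) mod ?K = b" by (auto simp: less_diff_conv)
  next
    fix p assume "p \<in> {p. active k p \<and> level (tok k 0 p) = j}"
    then have "j = p div ?K" by (auto simp: tok_0 activeD)
    then show "j * ?K + p mod ?K = p" by (simp only: div_mult_mod_eq)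
  qed
  from bij_betw_same_card[OF this] show ?case by simp
next
  case (Suc s)
  show ?case
  proof (cases "heavy k s (state k s) \<and> (\<exists>c. chosen k s (state k s) c)")
    case False
    then have "tok k (Suc s) p = tok k s p" if "active k p" for p
      using that by (auto intro!: tok_idle activeD)
    then have "{p. active k p \<and> level (tok k (Suc s) p) = j} = {p. active k p \<and> level (tok k s p) = j}"
      by auto
    with Suc show ?thesis by simp
  next
    case True
    then obtain c where h: "heavy k s (state k s)" and c: "chosen k s (state k s) c" by blast
    define l where "l = level (tok k s c)"
    define A where "A i = {p. active k p \<and> level (tok k s p) = i}" for i
    have fin: "finite (A i)" for i
      unfolding A_def by (rule finite_subset[of _ "{..<4^k}"]) (auto simp: activeD)
    have ac: "active k c" using c by (rule chosen_active)
    then have cA: "c \<in> A l" by (simp add: A_def l_def)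
    then have "card (A l) > 0" using fin by (auto simp: card_gt_0_iff)
    \<comment> \<open>Needed because subtraction is truncated: only then is
      \<open>2 ^ k - Suc l + 1\<close> equal to \<open>2 ^ k - l\<close>.\<close>
    then have l: "l < 2 ^ k" using Suc[of l] by (simp add: A_def)
    have lev: "level (tok k (Suc s) p) = (if p = c then l else Transposition.transpose l (Suc l) (level (tok k s p)))"
      if "active k p" for p
      using that tok_chosen(1)[OF h c] tok_other(1)[OF h c activeD] by (auto simp: l_def)
    have new: "{p. active k p \<and> level (tok k (Suc s) p) = j} =
        (if j = l then insert c (A (Suc l)) else if j = Suc l then A l - {c} else A j)"
      using ac lev by (auto simp: A_def l_def Transposition.transpose_def split: if_splits)
    have "c \<notin> A (Suc l)" by (simp add: A_def l_def)
    then show ?thesis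
      unfolding new using Suc l cA fin by (auto simp: A_def[symmetric])
  qed
qed

text \<open>Otherwise the \<open>2 ^ k\<close> tokens of level \<open>0\<close> together with the request would yield
  \<open>2 ^ k + 1\<close> disjoint sets of measure at least \<open>1 / 2 ^ k\<close>.\<close>

lemma heavy_imp_chosen:
  assumes "heavy k s (state k s)"
  shows "\<exists>c. chosen k s (state k s) c"
proof (rule ccontr)
  assume "\<nexists>c. chosen k s (state k s) c"
  then have nu: "\<not> usable k s (state k s) p" for p using ex_chosen by blast
  interpret prob_space cantor by (rule prob_space_cantor)
  define A where "A = {p. active k p \<and> level (tok k s p) = 0}"
  have fin: "finite A"
    unfolding A_def by (rule finite_subset[of _ "{..<4^k}"]) (auto simp: activeD)
  have disj: "request k s \<inter> clopen k s p = {}" if "p \<in> A" for p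
    using nu[of p] that unfolding disjoint_iff mem_request_iff usable_iff A_def by blast
  \<comment> \<open>An unusable active token has nonempty output, as the empty set lies in every
    target; hence \<open>clopen_measure\<close> yields its second alternative.\<close>
  have "1 / 2 ^ k \<le> prob (clopen k s p)" if "p \<in> A" for p
    using nu[of p] that clopen_measure[of p k s] by (auto simp: usable_iff A_def activeD)
  then have "(\<Sum>p\<in>A. 1 / 2 ^ k) \<le> (\<Sum>p\<in>A. prob (clopen k s p))"
    by (rule sum_mono)
  also have "\<dots> = prob (\<Union>p\<in>A. clopen k s p)"
    using fin by (subst finite_measure_finite_Union)
      (auto simp: disjoint_family_on_def A_def clopen_disjoint)
  finally have "1 \<le> prob (\<Union>p\<in>A. clopen k s p)"
    by (simp add: A_def card_level)
  then have "1 < prob (request k s) + prob (\<Union>p\<in>A. clopen k s p)"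
    using assms unfolding heavy_iff
    by (smt (verit) divide_pos_pos zero_less_power)
  also have "\<dots> = prob (request k s \<union> (\<Union>p\<in>A. clopen k s p))"
    using fin disj by (subst finite_measure_Union) auto
  also have "\<dots> \<le> 1" by simp
  finally show False by simp
qed

section \<open>Every heavy set is enumerated by some token\<close>

lemma sets_run: "{w. P (run w t)} \<in> sets cantor"
  using sets_prefix_code[of "\<lambda>v. P (outs v t)" t] by (simp add: outs_prefix_code)

lemma sets_result: "{w. result w = S} \<in> sets cantor"
proof -
  have [measurable]: "Measurable.pred cantor (\<lambda>w. y \<in> run w t)" for y t
    unfolding pred_def using sets_run[of "\<lambda>A. y \<in> A" t] by simp
  have "{w. result w = S} = {w \<in> space cantor. \<forall>y. (\<exists>t. y \<in> run w t) \<longleftrightarrow> y \<in> S}"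
    by (auto simp: result_eq_Union)
  then show ?thesis by (simp only:) measurable
qed

text \<open>Each sequence in \<open>X\<close> outputs the finite set \<open>Z\<close> after finitely
  many steps, so continuity from below applies.\<close>

lemma eventually_measure_run:
  assumes X: "X \<in> sets cantor" "X \<subseteq> {w. result w = S}" and Z: "finite Z" "Z \<subseteq> S"
    and r: "r < measure cantor X"
  shows "\<forall>\<^sub>F t in sequentially. r < measure cantor (X \<inter> {w. Z \<subseteq> run w t})"
proof -
  interpret prob_space cantor by (rule prob_space_cantor)
  have "\<exists>t. Z \<subseteq> run w t" if "w \<in> X" for w
  proof -
    have "\<exists>t. y \<in> run w t" if "y \<in> Z" for y
    proof -
      have "y \<in> result w" using that \<open>w \<in> X\<close> X(2) Z(2) by blast
      then show ?thesis by (simp add: result_eq_Union)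
    qed
    then have "\<forall>y\<in>Z. \<forall>\<^sub>F t in sequentially. y \<in> run w t"
      unfolding eventually_sequentially using run_mono by blast
    then have "\<forall>\<^sub>F t in sequentially. \<forall>y\<in>Z. y \<in> run w t"
      using Z(1) by (simp add: eventually_ball_finite)
    then show ?thesis by (auto simp: eventually_sequentially)
  qed
  then have "(\<Union>t. X \<inter> {w. Z \<subseteq> run w t}) = X" by auto
  moreover have "(\<lambda>t. prob (X \<inter> {w. Z \<subseteq> run w t})) \<longlonglongrightarrow> prob (\<Union>t. X \<inter> {w. Z \<subseteq> run w t})"
  proof (rule finite_Lim_measure_incseq)
    show "range (\<lambda>t. X \<inter> {w. Z \<subseteq> run w t}) \<subseteq> sets cantor"
      using X(1) sets_run by auto
    show "incseq (\<lambda>t. X \<inter> {w. Z \<subseteq> run w t})"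
      unfolding incseq_def using run_mono by blast
  qed
  ultimately show ?thesis using r by (metis order_tendstoD(1))
qed

lemma ex_token_enumerates:
  assumes "1 / 2 ^ k < measure cantor {w. result w = S}"
  shows "\<exists>p<4^k. (\<Union>s. enum_set k s p) = S"
proof (rule ccontr)
  assume no: "\<not> ?thesis"
  interpret prob_space cantor by (rule prob_space_cantor)
  let ?A = "{w. result w = S}"
  \<comment> \<open>A token either leaves \<open>S\<close> at some stage for good or misses a fixed
    element of \<open>S\<close> forever. There are finitely many tokens, so one \<open>b\<close>
    works for all.\<close>
  have "\<forall>\<^sub>F t in sequentially. enum_set k t p \<subseteq> S \<longrightarrow> (\<exists>y<t. y \<in> S \<and> (\<forall>s. y \<notin> enum_set k s p))"
    if p: "p < 4 ^ k" for p
  proof (cases "(\<Union>s. enum_set k s p) \<subseteq> S")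
    case True
    moreover have "(\<Union>s. enum_set k s p) \<noteq> S" using no p by metis
    ultimately obtain y where "y \<in> S" "y \<notin> (\<Union>s. enum_set k s p)" by blast
    then have "\<exists>y<t. y \<in> S \<and> (\<forall>s. y \<notin> enum_set k s p)" if "Suc y \<le> t" for t
      using that by (intro exI[of _ y]) auto
    then show ?thesis by (intro eventually_sequentiallyI[of "Suc y"]) simp
  next
    case False
    then obtain s where "\<not> enum_set k s p \<subseteq> S" by blast
    then have "\<not> enum_set k t p \<subseteq> S" if "s \<le> t" for t
      using enum_set_mono[OF p that] by blast
    then show ?thesis by (intro eventually_sequentiallyI[of s]) simp
  qed
  then have "\<forall>\<^sub>F t in sequentially. \<forall>p\<in>{..<4^k}. enum_set k t p \<subseteq> S \<longrightarrow>
      (\<exists>y<t. y \<in> S \<and> (\<forall>s. y \<notin> enum_set k s p))"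
    by (intro eventually_ball_finite) auto
  then obtain b where b: "\<And>p. p < 4 ^ k \<Longrightarrow> enum_set k b p \<subseteq> S \<Longrightarrow>
      \<exists>y<b. y \<in> S \<and> (\<forall>s. y \<notin> enum_set k s p)"
    unfolding eventually_sequentially by blast
  have missed: "\<not> S \<inter> {..<b} \<subseteq> enum_set k s p"
    if "p < 4 ^ k" "b \<le> s" "enum_set k s p \<subseteq> S" for p s
    using b[OF that(1)] enum_set_mono[OF that(1,2)] that(3) by blast
  \<comment> \<open>The hypothesis is strict, so some finite stage already retains measure above
    \<open>1 / 2 ^ k\<close>.\<close>
  have "\<forall>\<^sub>F t in sequentially. 1 / 2 ^ k < prob (?A \<inter> {w. S \<inter> {..<b} \<subseteq> run w t})"
    using assms sets_result by (intro eventually_measure_run[where S = S]) auto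
  then obtain t where t: "b \<le> t" "1 / 2 ^ k < prob (?A \<inter> {w. S \<inter> {..<b} \<subseteq> run w t})"
    unfolding eventually_sequentially by (meson nle_le)
  define A' where "A' = ?A \<inter> {w. S \<inter> {..<b} \<subseteq> run w t}"
  have "finite (\<Union>p<4^k. enum_set k t p)"
    by (auto simp: enum_set_def)
  then obtain m0 where m0: "(\<Union>p<4^k. enum_set k t p) \<subseteq> {..<m0}"
    using finite_nat_bounded by blast
  \<comment> \<open>With \<open>m0\<close> below \<open>m\<close>, a token reaching \<open>m\<close>
    or beyond must have moved since stage \<open>t\<close>; with \<open>b\<close> below
    \<open>m\<close>, the target \<open>T\<close> contains all of \<open>S\<close> below
    \<open>b\<close>.\<close>
  define m where "m = max b m0"
  define T where "T = S \<inter> {..<m}"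
  have "\<forall>\<^sub>F s in sequentially. 1 / 2 ^ k < prob (A' \<inter> {w. T \<subseteq> run w s})"
    using t(2) sets_result sets_run by (intro eventually_measure_run[where S = S]) (auto simp: A'_def T_def)
  then obtain s0 where s0: "\<And>s. s0 \<le> s \<Longrightarrow> 1 / 2 ^ k < prob (A' \<inter> {w. T \<subseteq> run w s})"
    unfolding eventually_sequentially by blast
  \<comment> \<open>The padding \<open>max s0 t\<close> pushes the stage beyond both
    \<open>s0\<close> and \<open>t\<close>.\<close>
  define s where "s = prod_encode (prod_encode (m, set_encode T), max s0 t)"
  have s: "bound s = m" "set_decode (target s) = T" "s0 \<le> s" "t \<le> s"
    using le_prod_encode_2[of "max s0 t" "prod_encode (m, set_encode T)"]
    by (auto simp: s_def bound_def target_def T_def)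
  \<comment> \<open>If such a token remembered \<open>w\<close>, its output would be a truncated run
    of \<open>w\<close>, hence inside \<open>S\<close> and reaching beyond \<open>m\<close>. It
    would then have moved after \<open>t\<close>, when \<open>w\<close> had already output all of
    \<open>S\<close> below \<open>b\<close>, contradicting \<open>missed\<close>.\<close>
  have miss: "w \<notin> clopen k s q"
    if w: "w \<in> A'" and q: "q < 4 ^ k" "\<not> enum_set k s q \<subseteq> T" for w q
  proof
    assume "w \<in> clopen k s q"
    then obtain m' where m': "enum_set k s q = run w (time (tok k s q)) \<inter> {..<m'}"
      using clopen_run q(1) by blast
    then have sub: "enum_set k s q \<subseteq> S"
      using run_subset_result w by (auto simp: A'_def)
    obtain x where x: "x \<in> enum_set k s q" "x \<notin> T" using q(2) by blast
    with sub have "m \<le> x" by (auto simp: T_def)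
    have "enum_set k t q \<subseteq> {..<m0}" using m0 q(1) by blast
    with x(1) \<open>m \<le> x\<close> have "enum_set k s q \<noteq> enum_set k t q" by (auto simp: m_def)
    then have "t \<le> time (tok k s q)" using enum_set_unchanged[OF q(1) s(4)] by blast
    then have "S \<inter> {..<b} \<subseteq> run w (time (tok k s q))"
      using w run_mono by (fastforce simp: A'_def)
    moreover have "b \<le> m'" using x(1) \<open>m \<le> x\<close> m' by (auto simp: m_def)
    ultimately have "S \<inter> {..<b} \<subseteq> enum_set k s q" unfolding m' by auto
    then show False using missed[OF q(1) _ sub] s(4) t(1) by simp
  qed
  have "A' \<inter> {w. T \<subseteq> run w s} \<subseteq> request k s"
  proof
    fix w assume w: "w \<in> A' \<inter> {w. T \<subseteq> run w s}"
    then have "run w s \<inter> {..<m} = T"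
      using run_subset_result[of w s] by (auto simp: T_def A'_def)
    then show "w \<in> request k s"
      unfolding mem_request_iff s using miss w activeD by blast
  qed
  then have "prob (A' \<inter> {w. T \<subseteq> run w s}) \<le> prob (request k s)"
    by (intro finite_measure_mono) simp_all
  with s0[OF s(3)] have heavy: "heavy k s (state k s)" by (simp add: heavy_iff)
  then obtain c where c: "chosen k s (state k s) c" using heavy_imp_chosen by blast
  have "enum_set k (Suc s) c = T" using tok_chosen(2)[OF heavy c] s by simp
  moreover have "T \<subseteq> S" "S \<inter> {..<b} \<subseteq> T" "b \<le> Suc s"
    using s(4) t(1) by (auto simp: T_def m_def)
  ultimately show False
    using missed[OF activeD[OF chosen_active[OF c]], of "Suc s"] by simp
qed

section \<open>The deterministic machine\<close>

text \<open>The input \<open>1\<^sup>j 0 u v\<close> stands for the numbers \<open>k\<close> with the \<open>j\<close> binary digits \<open>u\<close> and \<open>p\<close>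
  with the \<open>2 * k\<close> binary digits \<open>v\<close>.\<close>

definition ones :: "nat \<Rightarrow> nat" where
  "ones x = (LEAST i. nth_code x i = 0)"

definition exponent :: "nat \<Rightarrow> nat" where
  "exponent x = (\<Sum>i<ones x. nth_code x (ones x + 1 + i) * 2 ^ i)"

definition index :: "nat \<Rightarrow> nat" where
  "index x = (\<Sum>i<2 * exponent x. nth_code x (2 * ones x + 1 + i) * 2 ^ i)"

text \<open>Dovetailing: a step number codes a stage together with a possible output, which is
  emitted if the token has enumerated it by that stage.\<close>

definition machine :: "bool list \<Rightarrow> nat \<Rightarrow> nat option" where
  "machine x t =
     (if snd (prod_decode t) \<in> enum_set (exponent (enc_str x)) (fst (prod_decode t)) (index (enc_str x))
      then Some (snd (prod_decode t)) else None)"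

lemma rec_ones:
  assumes "total_rec g"
  shows "total_rec (\<lambda>e. ones (g e))"
proof -
  \<comment> \<open>The default value 0 beyond the end makes the search for the separator stop on
    every input.\<close>
  have "nth_code x (length (list_decode x)) = 0" for x
    using nth_code_list_encode[of "list_decode x"] by simp
  then have "total_rec (\<lambda>x. LEAST i. nth_code x i = 0)"
    by (intro rec_Least rec_code_intros) blast
  then show ?thesis
    unfolding ones_def using assms by (rule tr_comp)
qed

lemma rec_exponent:
  assumes "total_rec g"
  shows "total_rec (\<lambda>e. exponent (g e))"
  unfolding exponent_def by (intro rec_code_intros rec_ones assms tr_comp[OF assms])

lemma rec_index:
  assumes "total_rec g"
  shows "total_rec (\<lambda>e. index (g e))"
  unfolding index_def by (intro rec_code_intros rec_ones rec_exponent assms tr_comp[OF assms])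

lemma det_machine_machine: "det_machine machine"
proof -
  define g where "g z = (let x = fst (prod_decode z); t = snd (prod_decode z) in
    if snd (prod_decode t) \<in> set_decode (enumerated (nth_code (state (exponent x) (fst (prod_decode t))) (index x)))
    then Suc (snd (prod_decode t)) else 0)" for z
  have "total_rec g"
    unfolding g_def Let_def
    by (intro rec_code_intros rec_state rec_exponent rec_index rec_token_parts)
  moreover have "machine x t = dec_opt (g (prod_encode (enc_str x, t)))" for x t
    by (simp add: machine_def dec_opt_def g_def enum_set_def tok_def)
  ultimately show ?thesis unfolding det_machine_def by blast
qed

lemma det_enum_machine:
  "det_enum machine x = (\<Union>s. enum_set (exponent (enc_str x)) s (index (enc_str x)))"
proof -
  have "y \<in> det_enum machine x" if "y \<in> enum_set (exponent (enc_str x)) s (index (enc_str x))" for y s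
    unfolding det_enum_def mem_Collect_eq machine_def
    using that by (intro exI[of _ "prod_encode (s, y)"]) simp
  moreover have "det_enum machine x \<subseteq> (\<Union>s. enum_set (exponent (enc_str x)) s (index (enc_str x)))"
    by (auto simp: det_enum_def machine_def split: if_splits)
  ultimately show ?thesis by blast
qed

section \<open>Input strings and their lengths\<close>

lemma sum_binary_digits:
  fixes a n :: nat
  assumes "a < 2 ^ n"
  shows "(\<Sum>i<n. of_bool (odd (a div 2 ^ i)) * 2 ^ i) = a"
proof -
  have "(\<Sum>i<n. of_bool (odd (a div 2 ^ i)) * 2 ^ i :: nat) = horner_sum of_bool 2 (map (bit a) [0..<n])"
    by (simp add: horner_sum_eq_sum bit_iff_odd atLeast0LessThan)
  also have "\<dots> = a"
    using assms by (simp add: horner_sum_bit_eq_take_bit take_bit_nat_eq_self)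
  finally show ?thesis .
qed

lemma ex_input:
  assumes "k < 2 ^ j" "p < 4 ^ k"
  shows "\<exists>x. length x = 2 * j + 1 + 2 * k \<and> exponent (enc_str x) = k \<and> index (enc_str x) = p"
proof -
  define x where "x = replicate j True @ False # map (\<lambda>i. odd (k div 2 ^ i)) [0..<j]
    @ map (\<lambda>i. odd (p div 2 ^ i)) [0..<2 * k]"
  have len: "length x = 2 * j + 1 + 2 * k" by (simp add: x_def)
  have nth: "nth_code (enc_str x) i = of_bool (x ! i)" if "i < length x" for i
    using that by (simp add: enc_str_def nth_code_list_encode)
  have 1: "x ! i" if "i < j" for i using that by (simp add: x_def nth_append)
  have 2: "\<not> x ! j" by (simp add: x_def nth_append)
  have 3: "x ! (j + 1 + i) = odd (k div 2 ^ i)" if "i < j" for i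
    using that by (simp add: x_def nth_append)
  have 4: "x ! (2 * j + 1 + i) = odd (p div 2 ^ i)" if "i < 2 * k" for i
    using that by (simp add: x_def nth_append)
  have ones: "ones (enc_str x) = j"
    unfolding ones_def
  proof (rule Least_equality)
    show "j \<le> i" if "nth_code (enc_str x) i = 0" for i
      using that nth[of i] 1[of i] len by (cases "i < j") auto
  qed (use nth[of j] 2 len in auto)
  have "exponent (enc_str x) = (\<Sum>i<j. of_bool (odd (k div 2 ^ i)) * 2 ^ i)"
    unfolding exponent_def ones using len by (intro sum.cong) (simp_all add: nth 3[simplified])
  also have "\<dots> = k" using assms(1) by (rule sum_binary_digits)
  finally have k: "exponent (enc_str x) = k" .
  have "index (enc_str x) = (\<Sum>i<2 * k. of_bool (odd (p div 2 ^ i)) * 2 ^ i)"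
    unfolding index_def ones k using len by (intro sum.cong) (simp_all add: nth 4[simplified])
  also have "\<dots> = p" using assms(2) by (intro sum_binary_digits) (simp add: power_mult)
  finally show ?thesis using len k by blast
qed

text \<open>Naming one of \<open>4 ^ k\<close> tokens costs \<open>2 * k\<close> bits, the source of
  the factor 2 in the theorem; the other \<open>2 * j + 1\<close> bits describe
  \<open>k\<close>.\<close>

lemma I_det_machine:
  assumes "1 / 2 ^ k < measure cantor {w. result w = S}" "k < 2 ^ j"
  shows "I_det machine S \<le> enat (2 * j + 1 + 2 * k)"
proof -
  obtain p where p: "p < 4 ^ k" "(\<Union>s. enum_set k s p) = S"
    using ex_token_enumerates[OF assms(1)] by blast
  obtain x where x: "length x = 2 * j + 1 + 2 * k" "exponent (enc_str x) = k" "index (enc_str x) = p"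
    using ex_input[OF assms(2) p(1)] by blast
  then have "det_enum machine x = S" using p(2) by (simp add: det_enum_machine)
  then have "I_det machine S \<le> enat (length x)"
    unfolding I_det_def by (intro INF_lower) simp
  then show ?thesis using x(1) by simp
qed

end

section \<open>Comparison with the universal deterministic machine\<close>

theorem theorem4:
  fixes D0 :: "bool list \<Rightarrow> nat \<Rightarrow> nat option"
    and M0 :: "bool list \<Rightarrow> nat option"
  assumes "universal_det D0"
    and "optimal_prob M0"
  shows "\<exists>C::real. \<forall>(S::nat set) (h::real). H_prob M0 S = ereal h \<longrightarrow>
           (\<exists>n. I_det D0 S = enat n \<and> real n \<le> 2 * h + C * log 2 (h + 2) + C)"
proof -
  interpret prob_space cantor by (rule prob_space_cantor)
  obtain f where f: "total_rec f" and M0: "\<And>\<sigma>. M0 \<sigma> = dec_opt (f (enc_str \<sigma>))"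
    using assms(2) unfolding optimal_prob_def prob_machine_def by blast
  interpret enumerator f by unfold_locales (rule f)
  have result: "prob_enum M0 w = result w" for w
  proof -
    have "dec_opt a = Some y \<longleftrightarrow> a = Suc y" for a y
      by (cases a) (auto simp: dec_opt_def)
    then show ?thesis unfolding prob_enum_def result_def M0 by simp
  qed
  \<comment> \<open>\<open>machine\<close> depends only on \<open>f\<close>, with \<open>k\<close>
    and the token supplied as input, so one constant serves all sets.\<close>
  obtain c where c: "\<And>S. I_det D0 S \<le> I_det machine S + enat c"
    using assms(1) det_machine_machine unfolding universal_det_def by blast
  show ?thesis
  \<comment> \<open>The 5 collects 2 from \<open>j + 1\<close> digits in place of \<open>j\<close>,
    1 from the separator and 2 from \<open>k \<le> h + 1\<close>; being at least 2, the constant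
    also serves as the logarithm's coefficient.\<close>
  proof (intro exI[of _ "real c + 5"] allI impI)
    fix S h assume H: "H_prob M0 S = ereal h"
    define q where "q = prob {w. result w = S}"
    have "q \<noteq> 0" and h: "h = - log 2 q"
      using H by (auto simp: H_prob_def result q_def Let_def split: if_splits)
    then have q: "0 < q" "q \<le> 1" by (simp_all add: q_def zero_less_measure_iff)
    then have "0 \<le> h" by (simp add: h)
    \<comment> \<open>Adding 1 to the floor gives \<open>h < k\<close> even for integral
      \<open>h\<close>, as the strict measure bound requires.\<close>
    define k where "k = nat \<lfloor>h\<rfloor> + 1"
    have k: "h < real k" "real k \<le> h + 1"
      using \<open>0 \<le> h\<close> unfolding k_def by linarith+
    have "log 2 (1 / 2 ^ k) < log 2 q"
      using k(1) by (simp add: log_divide log_nat_power h)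
    then have "1 / 2 ^ k < prob {w. result w = S}"
      using q(1) by (simp add: q_def)
    moreover obtain j where j: "2 ^ j \<le> k" "k < 2 ^ (j + 1)"
      using ex_power_ivl1[of 2 k] by (auto simp: k_def)
    ultimately have "I_det machine S \<le> enat (2 * (j + 1) + 1 + 2 * k)"
      by (intro I_det_machine)
    then have "I_det D0 S \<le> enat (2 * (j + 1) + 1 + 2 * k + c)"
      using c[of S] by (metis add_right_mono order_trans plus_enat_simps(1))
    then obtain n where n: "I_det D0 S = enat n" "n \<le> 2 * (j + 1) + 1 + 2 * k + c"
      by (cases "I_det D0 S") auto
    have "real j \<le> log 2 (h + 2)"
    proof -
      have "real (2 ^ j) \<le> real k" using j(1) by (rule of_nat_mono)
      then have "2 ^ j \<le> h + 2" using k(2) unfolding of_nat_power of_nat_numeral by linarith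
      then show ?thesis using \<open>0 \<le> h\<close> by (simp add: le_log_iff powr_realpow)
    qed
    moreover have "real n \<le> real (2 * (j + 1) + 1 + 2 * k + c)" using n(2) by (rule of_nat_mono)
    ultimately have "real n \<le> 2 * h + 2 * log 2 (h + 2) + (real c + 5)" using k(2) by simp
    moreover have "2 * log 2 (h + 2) \<le> (real c + 5) * log 2 (h + 2)"
      using \<open>0 \<le> h\<close> by (intro mult_right_mono) auto
    ultimately show "\<exists>n. I_det D0 S = enat n \<and>
        real n \<le> 2 * h + (real c + 5) * log 2 (h + 2) + (real c + 5)"
      using n(1) by auto
  qed
qed

end
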